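(* Let $\Gamma$ be a finite simplicial graph with vertex set $V$, and suppose there is a system of moves $m: V\to 2^V$, $v\mapsto m_v$, for $\Gamma$ with a legal orbit. Then the right-angled Coxeter group $G=G(\Gamma)$ has a finite index subgroup $G'$ such that there is an epimorphism $G'\to\mathbb{Z}$ with finitely generated kernel.
   Context: Let $\Gamma=\Gamma(V,E)$ be a simplicial graph. A state is a subset $S\subset V$; it is legal if the subgraphs of $\Gamma$ induced by $S$ and by $V-S$ are both nonempty and connected. A move at $v\in V$ is a subset $m_v\subset V$ with $v\in m_v$ and $u\notin m_v$ whenever $\{u,v\}\in E$. A system of moves is a choice of a move $m_v$ for each $v\in V$ (the $m_v$ need not be distinct). Identify $2^V$ with the group $\mathbb{Z}_2^V$ (multiplication is symmetric difference), and let $M\le\mathbb{Z}_2^V$ be the subgroup generated by the moves; $M$ acts on the set of states by symmetric difference. A legal orbit is an $M$-orbit all of whose elements are legal states. $G(\Gamma)$ is the right-angled Coxeter group with generators $v\in V$ and relations $v^2=1$ for $v\in V$ and $uv=vu$ for $\{u,v\}\in E$. *)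

theory Defs
  imports
    "HOL-Algebra.Elementary_Groups"
    "HOL-Algebra.Group_Action"
    "Graph_Theory.Digraph_Component"
begin

section \<open>Groups given by generators and relations\<close>

text \<open>
  A letter \<open>(x, True)\<close> stands for the generator \<open>x\<close>, a letter \<open>(x, False)\<close> for its formal
  inverse.  A relation \<open>l = r\<close> is the pair \<open>(l, r)\<close> of words.
\<close>

type_synonym 'a gword = "('a \<times> bool) list"

definition gwords :: "'a set \<Rightarrow> 'a gword set" where
  "gwords X = lists (X \<times> UNIV)"

inductive_set pres_rel :: "'a set \<Rightarrow> ('a gword \<times> 'a gword) set \<Rightarrow> ('a gword \<times> 'a gword) set"
  for X :: "'a set" and R :: "('a gword \<times> 'a gword) set" where
  refl: "w \<in> gwords X \<Longrightarrow> (w, w) \<in> pres_rel X R"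
| sym: "(u, v) \<in> pres_rel X R \<Longrightarrow> (v, u) \<in> pres_rel X R"
| trans: "(u, v) \<in> pres_rel X R \<Longrightarrow> (v, w) \<in> pres_rel X R \<Longrightarrow> (u, w) \<in> pres_rel X R"
| append: "(u, u') \<in> pres_rel X R \<Longrightarrow> (v, v') \<in> pres_rel X R \<Longrightarrow> (u @ v, u' @ v') \<in> pres_rel X R"
| cancel: "x \<in> X \<Longrightarrow> ([(x, b), (x, \<not> b)], []) \<in> pres_rel X R"
| relation: "(l, r) \<in> R \<Longrightarrow> l \<in> gwords X \<Longrightarrow> r \<in> gwords X \<Longrightarrow> (l, r) \<in> pres_rel X R"

definition presented_group :: "'a set \<Rightarrow> ('a gword \<times> 'a gword) set \<Rightarrow> 'a gword set monoid" where
  "presented_group X R =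
    \<lparr> carrier = gwords X // pres_rel X R,
      monoid.mult = (\<lambda>A B. \<Union>u\<in>A. \<Union>v\<in>B. pres_rel X R `` {u @ v}),
      one = pres_rel X R `` {[]} \<rparr>"

lemma pres_rel_in_gwords:
  assumes "(u, v) \<in> pres_rel X R"
  shows "u \<in> gwords X \<and> v \<in> gwords X"
  using assms by induction (auto simp: gwords_def)

lemma equiv_pres_rel: "equiv (gwords X) (pres_rel X R)"
  by (rule equivI)
    (auto intro!: refl_onI symI transI intro: pres_rel.intros dest: pres_rel_in_gwords)

lemma presented_group_mult_class:
  assumes "u \<in> gwords X" "v \<in> gwords X"
  shows "(pres_rel X R `` {u}) \<otimes>\<^bsub>presented_group X R\<^esub> (pres_rel X R `` {v}) =
         pres_rel X R `` {u @ v}"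
proof -
  have "congruent2 (pres_rel X R) (pres_rel X R) (\<lambda>u v. pres_rel X R `` {u @ v})"
    by (rule congruent2I')
      (metis equiv_class_eq equiv_pres_rel pres_rel.append)
  from UN_equiv_class2[OF equiv_pres_rel equiv_pres_rel this assms]
  show ?thesis by (simp add: presented_group_def)
qed

lemma group_presented_group: "group (presented_group X R)"
proof -
  let ?P = "presented_group X R" and ?c = "\<lambda>w. pres_rel X R `` {w}"
  have app: "u @ v \<in> gwords X" if "u \<in> gwords X" "v \<in> gwords X" for u v :: "'a gword"
    using that by (simp add: gwords_def)
  have nil: "[] \<in> gwords X" by (simp add: gwords_def)
  have cl: "\<exists>w \<in> gwords X. A = ?c w" if "A \<in> carrier ?P" for A
    using that by (auto simp: presented_group_def elim: quotientE)
  have cc: "?c w \<in> carrier ?P" if "w \<in> gwords X" for w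
    using that by (auto simp: presented_group_def intro: quotientI)
  have one: "\<one>\<^bsub>?P\<^esub> = ?c []" by (simp add: presented_group_def)
  have linv: "\<exists>u \<in> gwords X. (u @ w, []) \<in> pres_rel X R" if "w \<in> gwords X" for w
    using that
  proof (induction w)
    case Nil
    then show ?case using nil pres_rel.refl[of "[]" X R] by force
  next
    case (Cons a w)
    obtain x b where a: "a = (x, b)" by (cases a)
    from Cons.prems have x: "x \<in> X" and w: "w \<in> gwords X" by (auto simp: gwords_def a)
    obtain u where u: "u \<in> gwords X" "(u @ w, []) \<in> pres_rel X R" using Cons.IH w by blast
    have "([(x, \<not> b), (x, b)], []) \<in> pres_rel X R"
      using pres_rel.cancel[OF x, of "\<not> b"] by simp
    then have "([(x, \<not> b), (x, b)] @ w, [] @ w) \<in> pres_rel X R"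
      using pres_rel.append pres_rel.refl w by metis
    then have "(u @ [(x, \<not> b), (x, b)] @ w, u @ [] @ w) \<in> pres_rel X R"
      using pres_rel.append pres_rel.refl u(1) by metis
    then have "((u @ [(x, \<not> b)]) @ a # w, []) \<in> pres_rel X R"
      using pres_rel.trans u(2) by (fastforce simp: a)
    moreover have "u @ [(x, \<not> b)] \<in> gwords X" using u(1) x by (simp add: gwords_def)
    ultimately show ?case by blast
  qed
  show ?thesis
  proof (rule groupI)
    fix A B assume "A \<in> carrier ?P" "B \<in> carrier ?P"
    then show "A \<otimes>\<^bsub>?P\<^esub> B \<in> carrier ?P"
      using cl cc app presented_group_mult_class by metis
  next
    show "\<one>\<^bsub>?P\<^esub> \<in> carrier ?P" using one cc nil by simp
  next
    fix A B C assume "A \<in> carrier ?P" "B \<in> carrier ?P" "C \<in> carrier ?P"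
    then obtain u v w where "u \<in> gwords X" "v \<in> gwords X" "w \<in> gwords X"
      "A = ?c u" "B = ?c v" "C = ?c w" using cl by meson
    then show "A \<otimes>\<^bsub>?P\<^esub> B \<otimes>\<^bsub>?P\<^esub> C = A \<otimes>\<^bsub>?P\<^esub> (B \<otimes>\<^bsub>?P\<^esub> C)"
      by (simp add: presented_group_mult_class app)
  next
    fix A assume "A \<in> carrier ?P"
    then obtain w where w: "w \<in> gwords X" "A = ?c w" using cl by meson
    show "\<one>\<^bsub>?P\<^esub> \<otimes>\<^bsub>?P\<^esub> A = A"
      using w by (simp add: one presented_group_mult_class nil)
    obtain u where "u \<in> gwords X" "(u @ w, []) \<in> pres_rel X R" using linv w(1) by blast
    then have "?c u \<otimes>\<^bsub>?P\<^esub> A = \<one>\<^bsub>?P\<^esub>"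
      using w equiv_class_eq[OF equiv_pres_rel] by (simp add: one presented_group_mult_class)
    then show "\<exists>B \<in> carrier ?P. B \<otimes>\<^bsub>?P\<^esub> A = \<one>\<^bsub>?P\<^esub>"
      using cc \<open>u \<in> gwords X\<close> by blast
  qed
qed

definition finitely_generated :: "('a, 'b) monoid_scheme \<Rightarrow> bool" where
  "finitely_generated G \<longleftrightarrow> (\<exists>S. finite S \<and> S \<subseteq> carrier G \<and> generate G S = carrier G)"

section \<open>Right-angled Coxeter groups\<close>

text \<open>
  A finite simplicial graph is a \<open>pair_graph\<close>, where an undirected edge \<open>{u, v}\<close> is
  represented by the two arcs \<open>(u, v)\<close> and \<open>(v, u)\<close>.
\<close>

definition racg_relations :: "'a pair_pre_digraph \<Rightarrow> ('a gword \<times> 'a gword) set" where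
  "racg_relations \<Gamma> =
    {([(v, True), (v, True)], []) | v. v \<in> pverts \<Gamma>} \<union>
    {([(u, True), (v, True)], [(v, True), (u, True)]) | u v. (u, v) \<in> parcs \<Gamma>}"

definition racg :: "'a pair_pre_digraph \<Rightarrow> 'a gword set monoid" where
  "racg \<Gamma> = presented_group (pverts \<Gamma>) (racg_relations \<Gamma>)"

lemma group_racg: "group (racg \<Gamma>)"
  by (simp add: racg_def group_presented_group)

section \<open>States, moves and legal orbits\<close>

text \<open>The library's \<open>connected\<close> includes nonemptiness of the vertex set.\<close>

definition legal_state :: "'a pair_pre_digraph \<Rightarrow> 'a set \<Rightarrow> bool" where
  "legal_state \<Gamma> S \<longleftrightarrow> S \<subseteq> pverts \<Gamma> \<and>
     connected (with_proj \<Gamma> \<restriction> S) \<and> connected (with_proj \<Gamma> \<restriction> (pverts \<Gamma> - S))"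

definition is_move :: "'a pair_pre_digraph \<Rightarrow> 'a \<Rightarrow> 'a set \<Rightarrow> bool" where
  "is_move \<Gamma> v A \<longleftrightarrow> A \<subseteq> pverts \<Gamma> \<and> v \<in> A \<and> (\<forall>u. (u, v) \<in> parcs \<Gamma> \<longrightarrow> u \<notin> A)"

definition system_of_moves :: "'a pair_pre_digraph \<Rightarrow> ('a \<Rightarrow> 'a set) \<Rightarrow> bool" where
  "system_of_moves \<Gamma> m \<longleftrightarrow> (\<forall>v \<in> pverts \<Gamma>. is_move \<Gamma> v (m v))"

text \<open>The group \<open>\<int>\<^sub>2\<^sup>V\<close>, as the subsets of \<open>V\<close> under symmetric difference.\<close>

definition power_group :: "'a set \<Rightarrow> 'a set monoid" where
  "power_group V = \<lparr> carrier = Pow V, monoid.mult = sym_diff, one = {} \<rparr>"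

lemma group_power_group: "group (power_group V)"
  by (rule groupI) (auto simp: power_group_def)

definition move_group :: "'a pair_pre_digraph \<Rightarrow> ('a \<Rightarrow> 'a set) \<Rightarrow> 'a set monoid" where
  "move_group \<Gamma> m = subgroup_generated (power_group (pverts \<Gamma>)) (m ` pverts \<Gamma>)"

definition legal_orbit :: "'a pair_pre_digraph \<Rightarrow> ('a \<Rightarrow> 'a set) \<Rightarrow> 'a set set \<Rightarrow> bool" where
  "legal_orbit \<Gamma> m Orb \<longleftrightarrow>
     Orb \<in> orbits (move_group \<Gamma> m) (Pow (pverts \<Gamma>)) sym_diff \<and> (\<forall>S \<in> Orb. legal_state \<Gamma> S)"

end

theory Submission
  imports Defs
begin

text \<open>
  The argument is Bestvina--Brady Morse theory on the Cayley graph of the Coxeter group \<open>G\<close>.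
  Fix a state \<open>S0\<close> in the legal orbit and attach to a group element \<open>g = v1 ... vn\<close> the state
  obtained from \<open>S0\<close> by the moves at \<open>v1, ..., vn\<close>.  The state at \<open>g\<close> orients the edges at \<open>g\<close>:
  the edge from \<open>g\<close> to \<open>g v\<close> ascends if \<open>v\<close> lies in the state and descends otherwise.  Since
  \<open>v \<in> m v\<close>, both ends of an edge agree on its direction; since \<open>u \<notin> m v\<close> for adjacent \<open>u, v\<close>,
  opposite sides of a commutation square are parallel.  Hence counting ascents minus descents
  along words gives an integer height on \<open>G\<close>, which is the content of \<open>walk_climb_pres_rel\<close>.

  The elements that return to the state \<open>S0\<close> form a subgroup of finite index, because there are
  only finitely many states, and on it height is additive.  States are nonempty, so height is
  unbounded above and, by pigeonhole on states, nonzero on this subgroup; dividing by the positive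
  generator of its image yields an epimorphism onto the integers.

  The kernel acts by left translation on the band of elements of height \<open>0\<close> or \<open>1\<close>, with at
  most one orbit for each pair of a state and a height.  A group acting on a connected graph with
  finitely many orbits of vertices, in which the edges come from finitely many generators, is
  finitely generated (\<open>fin_gen_of_connected_cocompact\<close>), so it remains to connect the band.
  Take any path in the Cayley graph between two elements of height \<open>0\<close>.  At a peak \<open>z\<close> both
  neighbours are \<open>z u\<close> and \<open>z v\<close> with \<open>u, v\<close> outside the state of \<open>z\<close>.  Legality says that the
  complement of the state is connected, and a path \<open>u = a0, a1, ..., an = v\<close> in it provides the
  detour \<open>z a0, z a0 a1, z a1, z a1 a2, ..., z an\<close>, which stays strictly below \<open>z\<close>
  (\<open>link_path\<close>).  This pushes the path down to height at most \<open>1\<close>.  Valleys below \<open>0\<close> are then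
  filled in the same way, using that the state itself is connected; these detours rise at most two
  above the valley and so do not exceed height \<open>1\<close> (\<open>band_connected\<close>).
\<close>

section \<open>Finite generation from a connected cocompact band\<close>

lemma finite_image_factor:
  assumes "finite (c ` X)"
    and "\<And>x y. x \<in> X \<Longrightarrow> y \<in> X \<Longrightarrow> c x = c y \<Longrightarrow> f x = f y"
  shows "finite (f ` X)"
proof -
  have "f ` X \<subseteq> (\<lambda>k. f (inv_into X c k)) ` c ` X"
  proof
    fix z assume "z \<in> f ` X"
    then obtain x where x: "x \<in> X" "z = f x" by blast
    have "f (inv_into X c (c x)) = f x"
      using x(1) by (intro assms(2)) (auto intro: inv_into_into f_inv_into_f)
    with x show "z \<in> (\<lambda>k. f (inv_into X c k)) ` c ` X" by force
  qed
  with assms(1) show ?thesis by (meson finite_imageI finite_subset)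
qed

text \<open>
  The Schreier argument: with a finite set \<open>P\<close> of coset representatives for \<open>B\<close>, a step by
  \<open>x \<in> X\<close> from the coset of \<open>p\<close> to that of \<open>q\<close> contributes the element \<open>p x q\<inverse>\<close> of \<open>K\<close>,
  and the product of these contributions along a path telescopes.
\<close>

lemma (in group) fin_gen_of_connected_cocompact:
  assumes K: "subgroup K G"
    and X: "finite X" "X \<subseteq> carrier G"
    and B: "B \<subseteq> carrier G" "\<one> \<in> B" "finite ((\<lambda>g. K #> g) ` B)"
    and conn: "\<And>k. k \<in> K \<Longrightarrow> (\<one>, k) \<in> (Restr {(g, g \<otimes> x) | g x. x \<in> X} B)\<^sup>*"
  shows "finitely_generated (G\<lparr>carrier := K\<rparr>)"
proof -
  define P where "P = insert \<one> (inv_into B (\<lambda>g. K #> g) ` (\<lambda>g. K #> g) ` B)"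
  \<comment> \<open>The part \<open>P \<inter> K\<close> absorbs the representative left over at the end of a path from \<open>\<one>\<close> to \<open>k\<close>.\<close>
  define Y where "Y = (P \<union> (\<lambda>(p, x, q). p \<otimes> x \<otimes> inv q) ` (P \<times> X \<times> P)) \<inter> K"
  have finP: "finite P" using B(3) by (simp add: P_def)
  have PB: "P \<subseteq> carrier G"
    using B by (auto simp: P_def intro: inv_into_into[THEN subsetD[OF B(1)]])
  have finY: "finite Y" using finP X(1) by (simp add: Y_def)
  have YK: "Y \<subseteq> K" by (simp add: Y_def)
  have Kc: "K \<subseteq> carrier G" using K by (rule subgroup.subset)
  have YG: "generate G Y \<subseteq> K" by (rule generate_subgroup_incl[OF YK K])
  have rep: "\<exists>k\<in>K. \<exists>q\<in>P. g = k \<otimes> q" if "g \<in> B" for g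
  proof -
    let ?q = "inv_into B (\<lambda>g. K #> g) (K #> g)"
    have q: "?q \<in> B" using that by (intro inv_into_into) simp
    have eq: "K #> ?q = K #> g"
      using that by (intro f_inv_into_f[of "K #> g" "\<lambda>g. K #> g" B]) simp
    have "g \<in> K #> ?q" using rcos_self[OF _ K, of g] that B(1) eq by auto
    moreover have "?q \<in> P" using that by (simp add: P_def)
    ultimately show ?thesis unfolding r_coset_def by blast
  qed
  have path: "\<exists>y\<in>generate G Y. \<exists>p\<in>P. g = y \<otimes> p"
    if "(\<one>, g) \<in> (Restr {(g, g \<otimes> x) | g x. x \<in> X} B)\<^sup>*" for g
    using that
  proof induction
    case base
    have "\<one> = \<one> \<otimes> \<one>" by simp
    then show ?case using generate.one[of G Y] unfolding P_def by blast
  next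
    case (step g h)
    then obtain y p x where *: "y \<in> generate G Y" "p \<in> P" "g = y \<otimes> p" "x \<in> X" "h = g \<otimes> x" "h \<in> B"
      by blast
    obtain k q where kq: "k \<in> K" "q \<in> P" "h = k \<otimes> q" using rep[OF \<open>h \<in> B\<close>] by blast
    have cs: "y \<in> carrier G" "p \<in> carrier G" "x \<in> carrier G" "q \<in> carrier G" "k \<in> carrier G"
      using * kq X(2) PB Kc YG by auto
    have eq: "y \<otimes> p \<otimes> x = k \<otimes> q" using * kq by simp
    have k: "y \<otimes> (p \<otimes> x \<otimes> inv q) = k"
    proof -
      have "y \<otimes> (p \<otimes> x \<otimes> inv q) = (y \<otimes> p \<otimes> x) \<otimes> inv q" using cs by (simp add: m_assoc)
      also have "\<dots> = k \<otimes> q \<otimes> inv q" by (simp only: eq)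
      also have "\<dots> = k" using cs by (simp add: m_assoc)
      finally show ?thesis .
    qed
    have "p \<otimes> x \<otimes> inv q = inv y \<otimes> k" using cs k by (metis inv_solve_left inv_closed m_closed)
    moreover have "inv y \<otimes> k \<in> K"
      using YG *(1) kq(1) K by (meson subgroup.m_closed subgroup.m_inv_closed subsetD)
    ultimately have "p \<otimes> x \<otimes> inv q \<in> Y" using *(2,4) kq(2) by (force simp: Y_def)
    then have "k \<in> generate G Y" using k *(1) by (metis generate.eng generate.incl)
    with kq show ?case by blast
  qed
  have "K \<subseteq> generate G Y"
  proof
    fix k assume k: "k \<in> K"
    obtain y p where yp: "y \<in> generate G Y" "p \<in> P" "k = y \<otimes> p" using path[OF conn[OF k]] by blast
    have "p = inv y \<otimes> k" using yp k YG PB Kc by (metis inv_solve_left subsetD)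
    also have "\<dots> \<in> K"
      using YG yp(1) k K by (meson subgroup.m_closed subgroup.m_inv_closed subsetD)
    finally have "p \<in> Y" using yp(2) by (simp add: Y_def)
    then show "k \<in> generate G Y" using yp by (simp add: generate.eng generate.incl)
  qed
  with YG have "generate G Y = K" by blast
  with finY YK K show ?thesis
    unfolding finitely_generated_def by (intro exI[of _ Y]) (simp add: generate_consistent)
qed

section \<open>Homomorphisms to the integers\<close>

text \<open>
  The image of the homomorphism is the set of multiples of its least positive element \<open>n\<close>, and
  division by \<open>n\<close> changes only the scale.
\<close>

lemma epi_integer_group_of_nontrivial_hom:
  assumes H: "group H" and f: "f \<in> hom H integer_group"
    and "x \<in> carrier H" "f x \<noteq> 0"
  obtains f' where "f' \<in> epi H integer_group"
    and "kernel H integer_group f' = kernel H integer_group f"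
proof -
  interpret H: group H by (rule H)
  interpret fh: group_hom H integer_group f
    using f by (simp add: group_hom_def group_hom_axioms_def H)
  define n where "n = (LEAST n. 0 < n \<and> int n \<in> f ` carrier H)"
  have "\<exists>n>0. int n \<in> f ` carrier H"
  proof (cases "f x > 0")
    case True
    then show ?thesis using assms(3) by (intro exI[of _ "nat (f x)"]) auto
  next
    case False
    have "f (inv\<^bsub>H\<^esub> x) = - f x" using assms(3) by simp
    then have "int (nat (- f x)) \<in> f ` carrier H"
      using False assms(3) by (metis H.inv_closed image_eqI int_nat_eq neg_0_le_iff_le not_less)
    then show ?thesis using False assms(4) by (intro exI[of _ "nat (- f x)"]) auto
  qed
  then have n: "0 < n" "int n \<in> f ` carrier H"
    unfolding n_def by (metis (mono_tags, lifting) LeastI_ex)+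
  then obtain g where g: "g \<in> carrier H" "f g = int n" by (metis imageE)
  have dvd: "int n dvd f y" if y: "y \<in> carrier H" for y
  proof (rule ccontr)
    assume "\<not> int n dvd f y"
    then have pos: "0 < f y mod int n" using n(1)
      by (metis dvd_eq_mod_eq_0 le_less of_nat_0_less_iff pos_mod_sign)
    let ?z = "y \<otimes>\<^bsub>H\<^esub> g [^]\<^bsub>H\<^esub> (- (f y div int n))"
    have z: "?z \<in> carrier H" using y g by simp
    have "f ?z = f y - (f y div int n) * int n"
      using y g by (simp add: fh.hom_int_pow)
    also have "\<dots> = f y mod int n" by (simp add: minus_div_mult_eq_mod)
    finally have "int (nat (f y mod int n)) \<in> f ` carrier H"
      using z pos by (metis image_eqI int_nat_eq less_le)
    then have "n \<le> nat (f y mod int n)" unfolding n_def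
      by (intro Least_le) (use pos n_def in auto)
    moreover have "f y mod int n < int n" using n(1) by simp
    ultimately show False using pos by linarith
  qed
  define f' where "f' = (\<lambda>y. f y div int n)"
  have ff: "f y = int n * f' y" if "y \<in> carrier H" for y
    using dvd[OF that] by (simp add: f'_def)
  have "f' \<in> hom H integer_group"
    using f dvd by (auto simp: hom_def f'_def div_plus_div_distrib_dvd_left)
  moreover have "\<exists>y\<in>carrier H. f' y = k" for k
  proof (rule bexI[of _ "g [^]\<^bsub>H\<^esub> k"])
    show "f' (g [^]\<^bsub>H\<^esub> k) = k" using g n(1) by (simp add: f'_def fh.hom_int_pow)
  qed (use g in simp)
  then have "f' ` carrier H = UNIV" by (metis UNIV_eq_I image_eqI)
  ultimately have "f' \<in> epi H integer_group" by (simp add: epi_def)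
  moreover have "kernel H integer_group f' = kernel H integer_group f"
    using ff n(1) by (auto simp: kernel_def)
  ultimately show ?thesis by (rule that)
qed

section \<open>Pushing paths below a level\<close>

text \<open>
  Consecutive vertices never have equal height, so a vertex at the top level \<open>n + 1\<close> of the path
  sits between two vertices of height at most \<open>n\<close> and can be bypassed on its own.
\<close>

lemma rtrancl_push_one_level:
  fixes h :: "'g \<Rightarrow> int"
  assumes level: "\<And>x y. (x, y) \<in> E \<Longrightarrow> h x \<noteq> h y"
    and link: "\<And>x z y. (x, z) \<in> E \<Longrightarrow> (z, y) \<in> E \<Longrightarrow> h z = n + 1 \<Longrightarrow> h x \<le> n \<Longrightarrow> h y \<le> n
      \<Longrightarrow> (x, y) \<in> (Restr E {w. h w \<le> n})\<^sup>*"
    and "(x, y) \<in> (Restr E {w. h w \<le> n + 1})\<^sup>*" "h x \<le> n" "h y \<le> n"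
  shows "(x, y) \<in> (Restr E {w. h w \<le> n})\<^sup>*"
proof -
  let ?R = "(Restr E {w. h w \<le> n})\<^sup>*"
  \<comment> \<open>While the path visits the top level, the induction remembers its last vertex below it.\<close>
  have "if h y \<le> n then (x, y) \<in> ?R else \<exists>w. (x, w) \<in> ?R \<and> h w \<le> n \<and> (w, y) \<in> E"
    using assms(3)
  proof induction
    case base
    then show ?case using assms(4) by simp
  next
    case (step y z)
    then have yz: "(y, z) \<in> E" "h y \<le> n + 1" "h z \<le> n + 1" by auto
    show ?case
    proof (cases "h y \<le> n")
      case True
      then have xy: "(x, y) \<in> ?R" using step.IH by simp
      show ?thesis
      proof (cases "h z \<le> n")
        case True
        with \<open>h y \<le> n\<close> yz have "(y, z) \<in> Restr E {w. h w \<le> n}" by simp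
        with xy True show ?thesis by (simp add: rtrancl.rtrancl_into_rtrancl)
      next
        case False
        then show ?thesis using xy yz \<open>h y \<le> n\<close> by auto
      qed
    next
      case False
      then obtain w where w: "(x, w) \<in> ?R" "h w \<le> n" "(w, y) \<in> E" using step.IH by auto
      have y: "h y = n + 1" using False yz by simp
      then have z: "h z \<le> n" using level[OF yz(1)] yz(3) by simp
      have "(w, z) \<in> ?R" by (rule link[OF w(3) yz(1) y w(2) z])
      with w(1) z show ?thesis by (simp add: rtrancl_trans[OF w(1)])
    qed
  qed
  with assms(5) show ?thesis by simp
qed

text \<open>A path is finite, so it has a highest level; the levels above \<open>c\<close> are removed one by one.\<close>

lemma rtrancl_push_below:
  fixes h :: "'g \<Rightarrow> int"
  assumes level: "\<And>x y. (x, y) \<in> E \<Longrightarrow> h x \<noteq> h y"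
    and link: "\<And>x z y. (x, z) \<in> E \<Longrightarrow> (z, y) \<in> E \<Longrightarrow> c < h z \<Longrightarrow> h x < h z \<Longrightarrow> h y < h z
      \<Longrightarrow> (x, y) \<in> (Restr E {w. h w < h z})\<^sup>*"
    and xy: "(x, y) \<in> E\<^sup>*" "h x \<le> c" "h y \<le> c"
  shows "(x, y) \<in> (Restr E {w. h w \<le> c})\<^sup>*"
proof -
  have mono: "(u, v) \<in> (Restr E {w. h w \<le> N})\<^sup>*"
    if "(u, v) \<in> (Restr E {w. h w \<le> M})\<^sup>*" "M \<le> N" for u v M N
    by (rule subsetD[OF rtrancl_mono that(1)]) (use that(2) in auto)
  have "\<exists>k::nat. (x, y) \<in> (Restr E {w. h w \<le> c + int k})\<^sup>*"
    using xy(1)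
  proof induction
    case base
    then show ?case by blast
  next
    case (step y z)
    then obtain k :: nat where k: "(x, y) \<in> (Restr E {w. h w \<le> c + int k})\<^sup>*" by blast
    let ?N = "c + int (k + nat (\<bar>h y\<bar> + \<bar>h z\<bar> + \<bar>c\<bar>))"
    have "(x, y) \<in> (Restr E {w. h w \<le> ?N})\<^sup>*" by (rule mono[OF k]) simp
    moreover have "(y, z) \<in> Restr E {w. h w \<le> ?N}" using step.hyps(2) by auto
    ultimately show ?case by (meson rtrancl.rtrancl_into_rtrancl)
  qed
  then obtain k :: nat where "(x, y) \<in> (Restr E {w. h w \<le> c + int k})\<^sup>*" by blast
  then show ?thesis
  proof (induction k)
    case 0
    then show ?case by simp
  next
    case (Suc k)
    let ?n = "c + int k"
    have "(x, y) \<in> (Restr E {w. h w \<le> ?n})\<^sup>*"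
    proof (rule rtrancl_push_one_level[OF level])
      fix u z v
      assume uzv: "(u, z) \<in> E" "(z, v) \<in> E" "h z = ?n + 1" "h u \<le> ?n" "h v \<le> ?n"
      then have "(u, v) \<in> (Restr E {w. h w < h z})\<^sup>*" by (intro link) auto
      then show "(u, v) \<in> (Restr E {w. h w \<le> ?n})\<^sup>*" using uzv(3) by simp
    next
      show "(x, y) \<in> (Restr E {w. h w \<le> ?n + 1})\<^sup>*"
        using Suc.prems by (simp add: algebra_simps)
    qed (use xy in auto)
    then show ?case by (rule Suc.IH)
  qed
qed

section \<open>States and heights of words\<close>

text \<open>
  The sign of a letter is ignored, because every generator of a Coxeter group is its own inverse.
\<close>

primrec walk :: "('a \<Rightarrow> 'a set) \<Rightarrow> 'a gword \<Rightarrow> 'a set \<Rightarrow> 'a set" where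
  "walk m [] S = S"
| "walk m (l # w) S = walk m w (sym_diff S (m (fst l)))"

primrec climb :: "('a \<Rightarrow> 'a set) \<Rightarrow> 'a gword \<Rightarrow> 'a set \<Rightarrow> int" where
  "climb m [] S = 0"
| "climb m (l # w) S = (if fst l \<in> S then 1 else -1) + climb m w (sym_diff S (m (fst l)))"

lemma walk_append: "walk m (u @ v) S = walk m v (walk m u S)"
  by (induction u arbitrary: S) auto

lemma climb_append: "climb m (u @ v) S = climb m u S + climb m v (walk m u S)"
  by (induction u arbitrary: S) auto

lemma sym_diff_assoc: "sym_diff (sym_diff A B) C = sym_diff A (sym_diff B C)"
  by auto

lemma walk_sym_diff: "walk m w (sym_diff S T) = sym_diff S (walk m w T)"
  by (induction w arbitrary: T) (simp_all only: walk.simps sym_diff_assoc)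

text \<open>
  The two axioms of a move are what makes state and height functions on the group.  For
  \<open>v v = 1\<close>, the move at \<open>v\<close> toggles \<open>v\<close> itself, so the second step undoes the first.  For
  \<open>u v = v u\<close>, the move at either letter leaves the membership of the other one alone, so both
  orders climb by the same amount.
\<close>

lemma walk_climb_pres_rel:
  assumes "symmetric (with_proj \<Gamma>)" and moves: "system_of_moves \<Gamma> m"
    and "(u, v) \<in> pres_rel (pverts \<Gamma>) (racg_relations \<Gamma>)"
  shows "walk m u S = walk m v S \<and> climb m u S = climb m v S"
  using assms(3)
proof (induction arbitrary: S)
  case (append u u' v v')
  then show ?case by (simp add: walk_append climb_append)
next
  case (cancel x b)
  then have "x \<in> m x" using moves by (simp add: system_of_moves_def is_move_def)
  then show ?case by auto
next
  case (relation l r)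
  then consider (square) v where "v \<in> pverts \<Gamma>" "l = [(v, True), (v, True)]" "r = []"
    | (commute) u v where "(u, v) \<in> parcs \<Gamma>" "l = [(u, True), (v, True)]" "r = [(v, True), (u, True)]"
    unfolding racg_relations_def by blast
  then show ?case
  proof cases
    case square
    then have "v \<in> m v" using moves by (simp add: system_of_moves_def is_move_def)
    then show ?thesis using square by auto
  next
    case commute
    then have "(v, u) \<in> parcs \<Gamma>" using assms(1) by (simp add: symmetric_def sym_def)
    moreover have "u \<in> pverts \<Gamma>" "v \<in> pverts \<Gamma>" using relation commute by (auto simp: gwords_def)
    ultimately have "u \<notin> m v" "v \<notin> m u"
      using moves commute by (auto simp: system_of_moves_def is_move_def)
    then show ?thesis using commute by auto
  qed
qed auto

section \<open>The Cayley graph of a right-angled Coxeter group with a legal orbit\<close>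

locale legal_racg =
  fixes \<Gamma> :: "'a pair_pre_digraph" and m :: "'a \<Rightarrow> 'a set" and S0 :: "'a set"
  assumes graph: "pair_graph \<Gamma>"
    and moves: "system_of_moves \<Gamma> m"
    and legal_walk: "\<And>w. w \<in> gwords (pverts \<Gamma>) \<Longrightarrow> legal_state \<Gamma> (walk m w S0)"
begin

abbreviation "G \<equiv> racg \<Gamma>"
abbreviation "V \<equiv> pverts \<Gamma>"

definition cls :: "'a gword \<Rightarrow> 'a gword set" where
  "cls w = pres_rel V (racg_relations \<Gamma>) `` {w}"

definition gen :: "'a \<Rightarrow> 'a gword set" where
  "gen v = cls [(v, True)]"

definition state :: "'a gword set \<Rightarrow> 'a set" where
  "state g = walk m (SOME w. w \<in> g) S0"

definition height :: "'a gword set \<Rightarrow> int" where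
  "height g = climb m (SOME w. w \<in> g) S0"

sublocale group G
  by (rule group_racg)

lemma finite_V: "finite V"
  using graph by (simp add: pair_graph_def pair_digraph_def pair_fin_digraph_def pair_fin_digraph_axioms_def)

lemma symmetric: "symmetric (with_proj \<Gamma>)"
  using graph by (metis pair_graph.axioms(2) pair_pseudo_graph.axioms(2) pair_sym_digraph.pair_sym_arcs)

lemma arc_sym: "(u, v) \<in> parcs \<Gamma> \<Longrightarrow> (v, u) \<in> parcs \<Gamma>"
  using symmetric by (simp add: symmetric_def sym_def)

lemma arc_verts: "(u, v) \<in> parcs \<Gamma> \<Longrightarrow> u \<in> V \<and> v \<in> V"
  using graph by (metis pair_graph.axioms(1) pair_digraph.axioms(1) pair_fin_digraph.axioms(1)
      pair_wf_digraph.in_arcsD1 pair_wf_digraph.in_arcsD2)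

lemma cls_cases:
  assumes "g \<in> carrier G"
  obtains w where "w \<in> gwords V" "g = cls w"
  using assms unfolding racg_def presented_group_def cls_def by (auto elim: quotientE)

lemma cls_closed: "w \<in> gwords V \<Longrightarrow> cls w \<in> carrier G"
  by (simp add: racg_def presented_group_def cls_def quotientI)

lemma cls_mult: "u \<in> gwords V \<Longrightarrow> v \<in> gwords V \<Longrightarrow> cls u \<otimes>\<^bsub>G\<^esub> cls v = cls (u @ v)"
  unfolding racg_def cls_def by (rule presented_group_mult_class)

lemma cls_one: "\<one>\<^bsub>G\<^esub> = cls []"
  by (simp add: racg_def presented_group_def cls_def)

lemma cls_eqI: "(u, v) \<in> pres_rel V (racg_relations \<Gamma>) \<Longrightarrow> cls u = cls v"
  unfolding cls_def by (rule equiv_class_eq[OF equiv_pres_rel])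

lemma state_height_cls:
  assumes "w \<in> gwords V"
  shows "state (cls w) = walk m w S0" "height (cls w) = climb m w S0"
proof -
  have "w \<in> cls w" using assms by (simp add: cls_def pres_rel.refl)
  then have "(SOME u. u \<in> cls w) \<in> cls w" by (rule someI)
  then have "(w, SOME u. u \<in> cls w) \<in> pres_rel V (racg_relations \<Gamma>)" by (simp add: cls_def)
  from walk_climb_pres_rel[OF symmetric moves this, of S0]
  show "state (cls w) = walk m w S0" "height (cls w) = climb m w S0"
    by (simp_all add: state_def height_def)
qed

lemma gwords_singleton: "[(v, b)] \<in> gwords V \<longleftrightarrow> v \<in> V"
  by (simp add: gwords_def)

lemma gwords_append: "u @ v \<in> gwords V \<longleftrightarrow> u \<in> gwords V \<and> v \<in> gwords V"
  by (auto simp: gwords_def)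

lemma gen_closed: "v \<in> V \<Longrightarrow> gen v \<in> carrier G"
  by (simp add: gen_def cls_closed gwords_singleton)

lemma gen_square: "v \<in> V \<Longrightarrow> gen v \<otimes>\<^bsub>G\<^esub> gen v = \<one>\<^bsub>G\<^esub>"
  by (auto simp: gen_def cls_mult gwords_singleton cls_one racg_relations_def gwords_def
      intro!: cls_eqI pres_rel.relation)

lemma gen_commute:
  assumes "(u, v) \<in> parcs \<Gamma>"
  shows "gen u \<otimes>\<^bsub>G\<^esub> gen v = gen v \<otimes>\<^bsub>G\<^esub> gen u"
  using assms arc_verts[OF assms]
  by (auto simp: gen_def cls_mult gwords_singleton racg_relations_def gwords_def
      intro!: cls_eqI pres_rel.relation)

lemma cls_letter: "v \<in> V \<Longrightarrow> cls [(v, b)] = gen v"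
proof (cases b)
  case False
  assume v: "v \<in> V"
  have "cls [(v, False)] \<otimes>\<^bsub>G\<^esub> gen v = cls [(v, False), (v, \<not> False)]"
    using v by (simp add: gen_def cls_mult gwords_singleton)
  also have "\<dots> = \<one>\<^bsub>G\<^esub>" unfolding cls_one by (rule cls_eqI) (rule pres_rel.cancel[OF v])
  also have "\<dots> = gen v \<otimes>\<^bsub>G\<^esub> gen v" using v by (simp add: gen_square)
  finally show ?thesis
    using False v by (simp add: cls_closed gwords_singleton gen_closed)
qed (simp add: gen_def)

lemma mult_gen_gen: "g \<in> carrier G \<Longrightarrow> v \<in> V \<Longrightarrow> g \<otimes>\<^bsub>G\<^esub> gen v \<otimes>\<^bsub>G\<^esub> gen v = g"
  by (simp add: m_assoc gen_closed gen_square)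

lemma state_one: "state \<one>\<^bsub>G\<^esub> = S0" and height_one: "height \<one>\<^bsub>G\<^esub> = 0"
  by (simp_all add: cls_one state_height_cls gwords_def)

text \<open>
  The state relative to \<open>S0\<close>, that is \<open>sym_diff (state g) S0\<close>, is a homomorphism to the group of
  subsets of \<open>V\<close>.
\<close>

lemma state_mult:
  assumes "g \<in> carrier G" "k \<in> carrier G"
  shows "state (g \<otimes>\<^bsub>G\<^esub> k) = sym_diff (sym_diff (state g) S0) (state k)"
proof -
  obtain u where u: "u \<in> gwords V" "g = cls u" using assms(1) by (rule cls_cases)
  obtain w where w: "w \<in> gwords V" "k = cls w" using assms(2) by (rule cls_cases)
  have "walk m w (walk m u S0) = walk m w (sym_diff (sym_diff (walk m u S0) S0) S0)"
    by (rule arg_cong[of _ _ "walk m w"]) auto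
  also have "\<dots> = sym_diff (sym_diff (walk m u S0) S0) (walk m w S0)" by (rule walk_sym_diff)
  finally show ?thesis
    using u w by (simp add: cls_mult state_height_cls gwords_append walk_append)
qed

text \<open>
  If \<open>g\<close> returns to \<open>S0\<close>, then a word for \<open>k\<close> traverses the same states from \<open>g\<close> as it does from
  the identity.
\<close>

lemma height_mult:
  assumes "g \<in> carrier G" "k \<in> carrier G" "state g = S0"
  shows "height (g \<otimes>\<^bsub>G\<^esub> k) = height g + height k"
proof -
  obtain u where u: "u \<in> gwords V" "g = cls u" using assms(1) by (rule cls_cases)
  obtain w where w: "w \<in> gwords V" "k = cls w" using assms(2) by (rule cls_cases)
  show ?thesis
    using u w assms(3) by (simp add: cls_mult state_height_cls gwords_append climb_append)
qed

lemma state_height_gen: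
  assumes "g \<in> carrier G" "v \<in> V"
  shows "state (g \<otimes>\<^bsub>G\<^esub> gen v) = sym_diff (state g) (m v)"
    and "height (g \<otimes>\<^bsub>G\<^esub> gen v) = height g + (if v \<in> state g then 1 else -1)"
proof -
  obtain u where u: "u \<in> gwords V" "g = cls u" using assms(1) by (rule cls_cases)
  then show "state (g \<otimes>\<^bsub>G\<^esub> gen v) = sym_diff (state g) (m v)"
    and "height (g \<otimes>\<^bsub>G\<^esub> gen v) = height g + (if v \<in> state g then 1 else -1)"
    using assms(2)
    by (simp_all add: gen_def cls_mult state_height_cls gwords_append gwords_singleton
        walk_append climb_append)
qed

lemma legal: "g \<in> carrier G \<Longrightarrow> legal_state \<Gamma> (state g)"
  by (metis cls_cases legal_walk state_height_cls(1))

lemma state_subset: "g \<in> carrier G \<Longrightarrow> state g \<subseteq> V"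
  using legal by (simp add: legal_state_def)

text \<open>
  The orbits of left translation by elements that fix \<open>S0\<close> are the sets of constant state, and
  height differs from one point of an orbit to another by the height of the translation.
\<close>

lemma same_state:
  assumes "x \<in> carrier G" "y \<in> carrier G" "state x = state y"
  shows "state (x \<otimes>\<^bsub>G\<^esub> inv\<^bsub>G\<^esub> y) = S0"
    and "height (x \<otimes>\<^bsub>G\<^esub> inv\<^bsub>G\<^esub> y) = height x - height y"
proof -
  let ?z = "x \<otimes>\<^bsub>G\<^esub> inv\<^bsub>G\<^esub> y"
  have z: "?z \<in> carrier G" and x: "x = ?z \<otimes>\<^bsub>G\<^esub> y"
    using assms(1,2) by (simp_all add: m_assoc)
  have "state x = sym_diff (sym_diff (state ?z) S0) (state y)"
    using state_mult[OF z assms(2)] x by simp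
  then show S: "state ?z = S0" using assms(3) by blast
  show "height ?z = height x - height y"
    using height_mult[OF z assms(2) S] x by simp
qed

definition cayley :: "'a gword set rel" where
  "cayley = {(g, g \<otimes>\<^bsub>G\<^esub> gen v) | g v. g \<in> carrier G \<and> v \<in> V}"

lemma cayley_sym: "(g, k) \<in> cayley \<Longrightarrow> \<exists>v\<in>V. k \<in> carrier G \<and> g = k \<otimes>\<^bsub>G\<^esub> gen v"
  unfolding cayley_def using mult_gen_gen gen_closed by fastforce

lemma cayley_connected:
  assumes "g \<in> carrier G"
  shows "(\<one>\<^bsub>G\<^esub>, g) \<in> cayley\<^sup>*"
proof -
  have "(\<one>\<^bsub>G\<^esub>, cls w) \<in> cayley\<^sup>*" if "w \<in> gwords V" for w
    using that
  proof (induction w rule: rev_induct)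
    case Nil
    then show ?case by (simp add: cls_one)
  next
    case (snoc l w)
    obtain v b where l: "l = (v, b)" by (cases l)
    have w: "w \<in> gwords V" "v \<in> V" using snoc.prems by (auto simp: gwords_def l)
    then have "cls (w @ [l]) = cls w \<otimes>\<^bsub>G\<^esub> gen v"
      by (simp add: cls_mult[symmetric] gwords_singleton l cls_letter)
    then have "(cls w, cls (w @ [l])) \<in> cayley" using w cls_closed by (auto simp: cayley_def)
    with snoc.IH[OF w(1)] show ?case by (rule rtrancl.rtrancl_into_rtrancl)
  qed
  with assms show ?thesis by (metis cls_cases)
qed

text \<open>
  A path in \<open>A\<close> is a path in the link of \<open>g\<close>: an edge between \<open>a\<close> and \<open>b\<close> spans the square
  \<open>g, g a, g a b = g b a, g b\<close>, and its far side leads from \<open>g a\<close> to \<open>g b\<close> without passing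
  through \<open>g\<close>.
\<close>

lemma link_path:
  assumes A: "A \<subseteq> V" "connected (with_proj \<Gamma> \<restriction> A)" "u \<in> A" "v \<in> A"
    and g: "g \<in> carrier G"
    and L1: "\<And>a. a \<in> A \<Longrightarrow> g \<otimes>\<^bsub>G\<^esub> gen a \<in> L"
    and L2: "\<And>a b. a \<in> A \<Longrightarrow> b \<in> A \<Longrightarrow> (a, b) \<in> parcs \<Gamma> \<Longrightarrow> g \<otimes>\<^bsub>G\<^esub> gen a \<otimes>\<^bsub>G\<^esub> gen b \<in> L"
  shows "(g \<otimes>\<^bsub>G\<^esub> gen u, g \<otimes>\<^bsub>G\<^esub> gen v) \<in> (Restr cayley L)\<^sup>*"
proof -
  have "(u, v) \<in> rtrancl_on A ((arcs_ends (with_proj \<Gamma> \<restriction> A))\<^sup>s)"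
    using A by (simp add: connected_conv)
  then have "(u, v) \<in> ((arcs_ends (with_proj \<Gamma> \<restriction> A))\<^sup>s)\<^sup>*" by (rule rtrancl_on_rtranclI)
  moreover have "(arcs_ends (with_proj \<Gamma> \<restriction> A))\<^sup>s \<subseteq> Restr (parcs \<Gamma>) A"
    using arc_sym by (auto simp: symcl_def arcs_ends_conv)
  ultimately have "(u, v) \<in> (Restr (parcs \<Gamma>) A)\<^sup>*" by (meson rtrancl_mono subsetD)
  then show ?thesis
  proof induction
    case base
    then show ?case by simp
  next
    case (step a b)
    then have ab: "a \<in> A" "b \<in> A" "(a, b) \<in> parcs \<Gamma>" by auto
    then have V: "a \<in> V" "b \<in> V" using A by auto
    let ?k = "g \<otimes>\<^bsub>G\<^esub> gen a \<otimes>\<^bsub>G\<^esub> gen b"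
    have "?k = g \<otimes>\<^bsub>G\<^esub> gen b \<otimes>\<^bsub>G\<^esub> gen a"
      using g V gen_commute[OF ab(3)] by (simp add: m_assoc gen_closed)
    then have kb: "?k \<otimes>\<^bsub>G\<^esub> gen a = g \<otimes>\<^bsub>G\<^esub> gen b" using g V by (simp add: mult_gen_gen gen_closed)
    have k: "?k \<in> carrier G" using g V by (simp add: gen_closed)
    have "(g \<otimes>\<^bsub>G\<^esub> gen a, ?k) \<in> Restr cayley L"
      using g V ab L1 L2 gen_closed by (auto simp: cayley_def)
    moreover have "(?k, g \<otimes>\<^bsub>G\<^esub> gen b) \<in> Restr cayley L"
      using k V ab L1 L2 kb by (force simp: cayley_def)
    ultimately show ?case using step.IH by (meson rtrancl.rtrancl_into_rtrancl)
  qed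
qed

lemma arc_not_in_move: "(a, b) \<in> parcs \<Gamma> \<Longrightarrow> b \<notin> m a"
  using moves arc_sym arc_verts by (simp add: system_of_moves_def is_move_def)

text \<open>
  Peaks are removed first.  A valley \<open>z\<close> has height at most \<open>-1\<close>, so the detour that fills it
  reaches height at most \<open>1\<close> and creates no new peaks.
\<close>

lemma band_connected:
  assumes "k \<in> carrier G" "height k = 0"
  shows "(\<one>\<^bsub>G\<^esub>, k) \<in> (Restr cayley {g. height g \<in> {0, 1}})\<^sup>*"
proof -
  have step: "\<exists>v\<in>V. z \<in> carrier G \<and> x = z \<otimes>\<^bsub>G\<^esub> gen v" if "(x, z) \<in> cayley \<or> (z, x) \<in> cayley" for x z
    using that cayley_sym unfolding cayley_def by blast
  have level: "height x \<noteq> height y" if xy: "(x, y) \<in> cayley" for x y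
  proof -
    obtain v where "x \<in> carrier G" "v \<in> V" "y = x \<otimes>\<^bsub>G\<^esub> gen v" using xy by (auto simp: cayley_def)
    then show ?thesis by (simp add: state_height_gen(2))
  qed
  let ?E = "Restr cayley {g. height g \<le> 1}"
  have 1: "(\<one>\<^bsub>G\<^esub>, k) \<in> ?E\<^sup>*"
  proof (rule rtrancl_push_below[OF level])
    fix x z y
    assume xz: "(x, z) \<in> cayley" and zy: "(z, y) \<in> cayley"
      and h: "height x < height z" "height y < height z"
    obtain u where u: "u \<in> V" "z \<in> carrier G" "x = z \<otimes>\<^bsub>G\<^esub> gen u" using step xz by blast
    obtain v where v: "v \<in> V" "y = z \<otimes>\<^bsub>G\<^esub> gen v" using step zy by blast
    have uv: "u \<in> V - state z" "v \<in> V - state z"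
      using h u v state_height_gen(2)[OF u(2)] by (auto split: if_splits)
    show "(x, y) \<in> (Restr cayley {w. height w < height z})\<^sup>*"
      unfolding u(3) v(2)
    proof (rule link_path[OF _ _ uv u(2)])
      show "connected (with_proj \<Gamma> \<restriction> (V - state z))" using legal[OF u(2)] by (simp add: legal_state_def)
      show "z \<otimes>\<^bsub>G\<^esub> gen a \<in> {w. height w < height z}" if "a \<in> V - state z" for a
        using that u(2) by (simp add: state_height_gen)
      show "z \<otimes>\<^bsub>G\<^esub> gen a \<otimes>\<^bsub>G\<^esub> gen b \<in> {w. height w < height z}"
        if "a \<in> V - state z" "b \<in> V - state z" "(a, b) \<in> parcs \<Gamma>" for a b
        using that u(2) arc_not_in_move[OF that(3)] by (simp add: state_height_gen gen_closed)
    qed auto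
  qed (use assms cayley_connected height_one in auto)
  have "(\<one>\<^bsub>G\<^esub>, k) \<in> (Restr ?E {w. - height w \<le> 0})\<^sup>*"
  proof (rule rtrancl_push_below[OF _ _ 1])
    fix x z y
    assume xz: "(x, z) \<in> ?E" and zy: "(z, y) \<in> ?E" and z0: "0 < - height z"
      and h: "- height x < - height z" "- height y < - height z"
    obtain u where u: "u \<in> V" "z \<in> carrier G" "x = z \<otimes>\<^bsub>G\<^esub> gen u" using step xz by blast
    obtain v where v: "v \<in> V" "y = z \<otimes>\<^bsub>G\<^esub> gen v" using step zy by blast
    have uv: "u \<in> state z" "v \<in> state z"
      using h u v state_height_gen(2)[OF u(2)] by (auto split: if_splits)
    let ?L = "{w. height z < height w \<and> height w \<le> 1}"
    have "(x, y) \<in> (Restr cayley ?L)\<^sup>*"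
      unfolding u(3) v(2)
    proof (rule link_path[OF state_subset[OF u(2)] _ uv u(2)])
      show "connected (with_proj \<Gamma> \<restriction> state z)" using legal[OF u(2)] by (simp add: legal_state_def)
      show "z \<otimes>\<^bsub>G\<^esub> gen a \<in> ?L" if "a \<in> state z" for a
        using that u(2) z0 state_subset[OF u(2)] by (auto simp: state_height_gen)
      show "z \<otimes>\<^bsub>G\<^esub> gen a \<otimes>\<^bsub>G\<^esub> gen b \<in> ?L"
        if "a \<in> state z" "b \<in> state z" "(a, b) \<in> parcs \<Gamma>" for a b
        using that u(2) z0 arc_not_in_move[OF that(3)] arc_verts[OF that(3)]
        by (simp add: state_height_gen gen_closed)
    qed
    moreover have "Restr cayley ?L \<subseteq> Restr ?E {w. - height w < - height z}" by auto
    ultimately show "(x, y) \<in> (Restr ?E {w. - height w < - height z})\<^sup>*"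
      by (meson rtrancl_mono subsetD)
  qed (use assms height_one level in auto)
  moreover have "Restr ?E {w. - height w \<le> 0} \<subseteq> Restr cayley {g. height g \<in> {0, 1}}" by auto
  ultimately show ?thesis by (meson rtrancl_mono subsetD)
qed

lemma height_unbounded: "\<exists>g\<in>carrier G. height g = int n"
proof (induction n)
  case 0
  then show ?case using height_one by force
next
  case (Suc n)
  then obtain g where g: "g \<in> carrier G" "height g = int n" by blast
  have "state g \<noteq> {}" using legal[OF g(1)] by (auto simp: legal_state_def connected_conv)
  then obtain v where v: "v \<in> state g" by blast
  then have "v \<in> V" using state_subset g(1) by blast
  then have "g \<otimes>\<^bsub>G\<^esub> gen v \<in> carrier G" "height (g \<otimes>\<^bsub>G\<^esub> gen v) = int (Suc n)"
    using g v by (simp_all add: state_height_gen gen_closed)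
  then show ?case by blast
qed

text \<open>
  Among elements of all heights \<open>0, 1, 2, ...\<close> two share a state, and their quotient fixes \<open>S0\<close>.
\<close>

lemma exists_nonzero_height: "\<exists>g\<in>carrier G. state g = S0 \<and> height g \<noteq> 0"
proof -
  obtain g where g: "\<And>n. g n \<in> carrier G" "\<And>n. height (g n) = int n"
    using height_unbounded by metis
  have "range (\<lambda>n. state (g n)) \<subseteq> Pow V" using state_subset g(1) by blast
  then have "finite (range (\<lambda>n. state (g n)))" using finite_V by (meson finite_Pow_iff finite_subset)
  then have "\<not> inj (\<lambda>n. state (g n))" using finite_imageD by blast
  then obtain i j where ij: "i \<noteq> j" "state (g i) = state (g j)" unfolding inj_def by blast
  show ?thesis
    using same_state[OF g(1) g(1) ij(2)] ij(1) g by (intro bexI[of _ "g i \<otimes>\<^bsub>G\<^esub> inv\<^bsub>G\<^esub> g j"]) auto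
qed

definition stab :: "'a gword set set" where
  "stab = {g \<in> carrier G. state g = S0}"

definition level_stab :: "'a gword set set" where
  "level_stab = {g \<in> stab. height g = 0}"

lemma subgroup_stab: "subgroup stab G"
proof (rule subgroupI)
  show "inv\<^bsub>G\<^esub> g \<in> stab" if "g \<in> stab" for g
    using that same_state(1)[of "\<one>\<^bsub>G\<^esub>" g] by (auto simp: stab_def state_one)
qed (use state_one one_closed in \<open>auto simp: stab_def state_mult\<close>)

lemma subgroup_level_stab: "subgroup level_stab G"
proof (rule subgroupI)
  show "inv\<^bsub>G\<^esub> g \<in> level_stab" if "g \<in> level_stab" for g
    using that same_state[of "\<one>\<^bsub>G\<^esub>" g] by (auto simp: level_stab_def stab_def state_one height_one)
qed (use state_one height_one one_closed in \<open>auto simp: level_stab_def stab_def state_mult height_mult\<close>)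

lemma finite_index_stab: "finite (rcosets\<^bsub>G\<^esub> stab)"
proof -
  have "finite ((\<lambda>g. stab #>\<^bsub>G\<^esub> g) ` carrier G)"
  proof (rule finite_image_factor)
    have "state ` carrier G \<subseteq> Pow V" using state_subset by blast
    then show "finite (state ` carrier G)" using finite_V by (meson finite_Pow_iff finite_subset)
    fix x y assume xy: "x \<in> carrier G" "y \<in> carrier G" "state x = state y"
    then have "x \<otimes>\<^bsub>G\<^esub> inv\<^bsub>G\<^esub> y \<in> stab" by (simp add: stab_def same_state)
    moreover have "x = x \<otimes>\<^bsub>G\<^esub> inv\<^bsub>G\<^esub> y \<otimes>\<^bsub>G\<^esub> y" using xy by (simp add: m_assoc)
    ultimately have "x \<in> stab #>\<^bsub>G\<^esub> y" unfolding r_coset_def by blast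
    then show "stab #>\<^bsub>G\<^esub> x = stab #>\<^bsub>G\<^esub> y"
      using repr_independence[OF _ xy(2) subgroup_stab] by simp
  qed
  moreover have "rcosets\<^bsub>G\<^esub> stab = (\<lambda>g. stab #>\<^bsub>G\<^esub> g) ` carrier G" by (auto simp: RCOSETS_def)
  ultimately show ?thesis by simp
qed

lemma fin_gen_level_stab: "finitely_generated (G\<lparr>carrier := level_stab\<rparr>)"
proof -
  let ?B = "{g \<in> carrier G. height g \<in> {0, 1}}"
  show ?thesis
  proof (rule fin_gen_of_connected_cocompact[OF subgroup_level_stab, of "gen ` V" ?B])
    show "finite ((\<lambda>g. level_stab #>\<^bsub>G\<^esub> g) ` ?B)"
    proof (rule finite_image_factor)
      have "(\<lambda>g. (state g, height g)) ` ?B \<subseteq> Pow V \<times> {0, 1}" using state_subset by blast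
      then show "finite ((\<lambda>g. (state g, height g)) ` ?B)"
        by (rule finite_subset) (simp add: finite_V)
      fix x y assume xy: "x \<in> ?B" "y \<in> ?B" "(state x, height x) = (state y, height y)"
      then have "x \<otimes>\<^bsub>G\<^esub> inv\<^bsub>G\<^esub> y \<in> level_stab" by (simp add: level_stab_def stab_def same_state)
      moreover have "x = x \<otimes>\<^bsub>G\<^esub> inv\<^bsub>G\<^esub> y \<otimes>\<^bsub>G\<^esub> y" using xy by (simp add: m_assoc)
      ultimately have "x \<in> level_stab #>\<^bsub>G\<^esub> y" unfolding r_coset_def by blast
      then show "level_stab #>\<^bsub>G\<^esub> x = level_stab #>\<^bsub>G\<^esub> y"
        using repr_independence[OF _ _ subgroup_level_stab] xy by simp
    qed
    fix k assume "k \<in> level_stab"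
    then have "(\<one>\<^bsub>G\<^esub>, k) \<in> (Restr cayley {g. height g \<in> {0, 1}})\<^sup>*"
      by (intro band_connected) (auto simp: level_stab_def stab_def)
    moreover have "Restr cayley {g. height g \<in> {0, 1}}
        \<subseteq> Restr {(g, g \<otimes>\<^bsub>G\<^esub> x) | g x. x \<in> gen ` V} ?B"
      using gen_closed by (auto simp: cayley_def)
    ultimately show "(\<one>\<^bsub>G\<^esub>, k) \<in> (Restr {(g, g \<otimes>\<^bsub>G\<^esub> x) | g x. x \<in> gen ` V} ?B)\<^sup>*"
      by (meson rtrancl_mono subsetD)
  qed (use finite_V gen_closed height_one in auto)
qed

lemma stab_fibers:
  "\<exists>f. f \<in> epi (G\<lparr>carrier := stab\<rparr>) integer_group
      \<and> finitely_generated (G\<lparr>carrier := kernel (G\<lparr>carrier := stab\<rparr>) integer_group f\<rparr>)"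
proof -
  have "group (G\<lparr>carrier := stab\<rparr>)" by (rule subgroup_imp_group[OF subgroup_stab])
  moreover have "height \<in> hom (G\<lparr>carrier := stab\<rparr>) integer_group"
    by (auto simp: hom_def stab_def height_mult)
  moreover obtain x where "x \<in> carrier (G\<lparr>carrier := stab\<rparr>)" "height x \<noteq> 0"
    using exists_nonzero_height by (auto simp: stab_def)
  ultimately obtain f where "f \<in> epi (G\<lparr>carrier := stab\<rparr>) integer_group"
    "kernel (G\<lparr>carrier := stab\<rparr>) integer_group f = kernel (G\<lparr>carrier := stab\<rparr>) integer_group height"
    by (rule epi_integer_group_of_nontrivial_hom)
  moreover have "kernel (G\<lparr>carrier := stab\<rparr>) integer_group height = level_stab"
    by (auto simp: kernel_def level_stab_def)
  ultimately show ?thesis using fin_gen_level_stab by metis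
qed

end

lemma legal_racg_of_legal_orbit:
  assumes "pair_graph \<Gamma>" "system_of_moves \<Gamma> m" "legal_orbit \<Gamma> m Orb"
  obtains S0 where "legal_racg \<Gamma> m S0"
proof -
  let ?M = "move_group \<Gamma> m"
  obtain S0 where S0: "Orb = {sym_diff A S0 | A. A \<in> carrier ?M}"
    using assms(3) by (auto simp: legal_orbit_def orbits_def orbit_def)
  have M: "carrier ?M = generate (power_group (pverts \<Gamma>)) (m ` pverts \<Gamma>)"
  proof -
    have "m ` pverts \<Gamma> \<subseteq> carrier (power_group (pverts \<Gamma>))"
      using assms(2) by (auto simp: system_of_moves_def is_move_def power_group_def)
    then show ?thesis by (simp add: move_group_def carrier_subgroup_generated inf_absorb2)
  qed
  have closed: "sym_diff S (m v) \<in> Orb" if S: "S \<in> Orb" and v: "v \<in> pverts \<Gamma>" for S v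
  proof -
    obtain A where A: "A \<in> carrier ?M" "S = sym_diff A S0" using S S0 by blast
    have "A \<otimes>\<^bsub>power_group (pverts \<Gamma>)\<^esub> m v \<in> carrier ?M"
      using A(1) v unfolding M by (intro generate.eng) (auto intro: generate.incl)
    then have "sym_diff A (m v) \<in> carrier ?M" by (simp add: power_group_def)
    moreover have "sym_diff S (m v) = sym_diff (sym_diff A (m v)) S0" using A(2) by auto
    ultimately show ?thesis using S0 by blast
  qed
  have "\<one>\<^bsub>power_group (pverts \<Gamma>)\<^esub> \<in> carrier ?M" unfolding M by (rule generate.one)
  then have "{} \<in> carrier ?M" by (simp add: power_group_def)
  then have start: "S0 \<in> Orb" using S0 by force
  have walk: "walk m w S \<in> Orb" if "w \<in> gwords (pverts \<Gamma>)" "S \<in> Orb" for w S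
    using that
  proof (induction w arbitrary: S)
    case (Cons l w)
    then show ?case by (auto simp: gwords_def intro!: Cons.IH closed)
  qed simp
  have "legal_racg \<Gamma> m S0"
    by (rule legal_racg.intro) (use assms walk[OF _ start] in \<open>auto simp: legal_orbit_def\<close>)
  then show ?thesis by (rule that)
qed

theorem corollary4p4:
  fixes \<Gamma> :: "'a pair_pre_digraph" and m :: "'a \<Rightarrow> 'a set"
  assumes "pair_graph \<Gamma>"
    and "system_of_moves \<Gamma> m"
    and "\<exists>Orb. legal_orbit \<Gamma> m Orb"
  shows "\<exists>G' f. subgroup G' (racg \<Gamma>)
      \<and> finite (rcosets\<^bsub>racg \<Gamma>\<^esub> G')
      \<and> f \<in> epi (racg \<Gamma>\<lparr>carrier := G'\<rparr>) integer_group
      \<and> finitely_generated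
          (racg \<Gamma>\<lparr>carrier := kernel (racg \<Gamma>\<lparr>carrier := G'\<rparr>) integer_group f\<rparr>)"
proof -
  obtain S0 where "legal_racg \<Gamma> m S0"
    using assms legal_racg_of_legal_orbit by metis
  then interpret legal_racg \<Gamma> m S0 .
  show ?thesis
    using subgroup_stab finite_index_stab stab_fibers by blast
qed

end
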